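(* Let $s\ge 2$ and $n_1,\dots,n_s\ge 2$ be integers, and let $G=KP(n_1,n_2,\ldots,n_s)$ be the clique-path on these cliques. Then $q(G)=s+1$.
   Context: All graphs are finite and simple. For a graph $G$ with vertex set $\{1,\dots,n\}$, $\mathcal{S}(G)$ is the set of real symmetric $n\times n$ matrices $A=[a_{ij}]$ such that for $i\neq j$, $a_{ij}\neq 0$ if and only if $ij$ is an edge of $G$ (diagonal entries are unrestricted). For a matrix $A$, $q(A)$ is the number of distinct eigenvalues of $A$, and $q(G)=\min\{q(A): A\in\mathcal{S}(G)\}$. If $G$ and $G'$ are graphs whose vertex sets intersect in exactly one vertex $v$, their vertex sum is the union graph $G\cup G'$ (vertex set and edge set are the unions); $v$ is the summing vertex. For $s\ge 2$ and $n_i\ge 2$, the clique-path $KP(n_1,\dots,n_s)$ is the graph obtained from complete graphs $K_{n_1},K_{n_2},\dots,K_{n_s}$, in this order, by successive vertex sums where $K_{n_{i+1}}$ is glued to $K_{n_i}$ at a single vertex, and all summing vertices are distinct (so consecutive cliques share exactly one vertex, nonconsecutive cliques share none). *)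

theory Defs
  imports
    "Jordan_Normal_Form.Spectral_Radius"
    "Graph_Theory.Pair_Digraph"
    "Graph_Theory.Kuratowski"
begin

text \<open>
  A finite simple graph is a symmetric loop-free digraph whose arcs are pairs of vertices
  (\<open>pair_graph\<close>); the undirected edge \<open>uv\<close> is the pair of arcs \<open>(u, v)\<close>, \<open>(v, u)\<close>.
\<close>

text \<open>
  Intended for graphs with vertex set \<open>{0..<n}\<close>, matching the zero-based indexing of matrices.
\<close>

definition sym_mats_of_graph :: "nat pair_pre_digraph \<Rightarrow> real mat set" where
  "sym_mats_of_graph G =
     {A. A \<in> carrier_mat (card (pverts G)) (card (pverts G)) \<and> A\<^sup>T = A \<and>
         (\<forall>i < card (pverts G). \<forall>j < card (pverts G).
            i \<noteq> j \<longrightarrow> (A $$ (i, j) \<noteq> 0 \<longleftrightarrow> (i, j) \<in> parcs G))}"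

text \<open>
  Real eigenvalues suffice, since this is only applied to real symmetric matrices.
\<close>

definition q_mat :: "real mat \<Rightarrow> nat" where
  "q_mat A = card (spectrum A)"

text \<open>
  On \<open>nat\<close> the infimum of a nonempty set is its minimum, and \<open>sym_mats_of_graph G\<close> contains
  the adjacency matrix of \<open>G\<close>.
\<close>

definition q_graph :: "nat pair_pre_digraph \<Rightarrow> nat" where
  "q_graph G = Inf (q_mat ` sym_mats_of_graph G)"

definition vertex_sum :: "'a pair_pre_digraph \<Rightarrow> 'a pair_pre_digraph \<Rightarrow> 'a pair_pre_digraph" where
  "vertex_sum G H = \<lparr>pverts = pverts G \<union> pverts H, parcs = parcs G \<union> parcs H\<rparr>"

text \<open>
  \<open>clique_path_constr ns G K U\<close>: \<open>G\<close> arises from complete graphs of orders \<open>ns\<close> by successive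
  vertex sums, \<open>K\<close> is the clique added last, and \<open>U\<close> is the set of summing vertices used so far.
  The condition \<open>v \<notin> U\<close> makes all summing vertices distinct.
\<close>

inductive clique_path_constr ::
  "nat list \<Rightarrow> 'a pair_pre_digraph \<Rightarrow> 'a pair_pre_digraph \<Rightarrow> 'a set \<Rightarrow> bool"
where
  single: "complete_digraph n (with_proj K) \<Longrightarrow> clique_path_constr [n] K K {}"
| glue: "\<lbrakk>clique_path_constr ns G K U; complete_digraph n (with_proj L);
          pverts G \<inter> pverts L = {v}; v \<in> pverts K; v \<notin> U\<rbrakk>
         \<Longrightarrow> clique_path_constr (ns @ [n]) (vertex_sum G L) L (insert v U)"

definition clique_path :: "nat list \<Rightarrow> 'a pair_pre_digraph \<Rightarrow> bool" where
  "clique_path ns G \<longleftrightarrow> (\<exists>K U. clique_path_constr ns G K U)"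

end

theory Submission
  imports Defs
begin

text \<open>
  Upper bound: if \<open>M\<close> is the vertex-clique incidence matrix, then \<open>M M\<^sup>T\<close> has the pattern of \<open>G\<close>,
  and its nonzero eigenvalues are eigenvalues of the \<open>s \<times> s\<close> matrix \<open>M\<^sup>T M\<close>.

  Lower bound: the clique-path contains vertices \<open>p\<^sub>0, \<dots>, p\<^sub>s\<close> which form the unique shortest path
  from \<open>p\<^sub>0\<close> to each \<open>p\<^sub>k\<close>. Hence for a matrix \<open>A\<close> with the pattern of \<open>G\<close>, the entry of
  \<open>A\<^sup>k e\<close> at \<open>p\<^sub>k\<close>, with \<open>e\<close> the unit vector of \<open>p\<^sub>0\<close>, is nonzero, while that of \<open>A\<^sup>j e\<close> vanishes for
  \<open>j < k\<close>. So the polynomial of least degree with \<open>q(A) e = 0\<close> has degree at least \<open>s + 1\<close>;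
  as \<open>A\<close> is real symmetric, the roots of \<open>q\<close> are simple, real, and eigenvalues of \<open>A\<close>.
\<close>

section \<open>Annihilating polynomials of a vector\<close>

text \<open>Encodes q(A) x through the iterates A^k x, so that no polynomial in matrices has to be
  formed.\<close>

definition poly_act :: "'a :: comm_ring_1 mat \<Rightarrow> 'a vec \<Rightarrow> 'a poly \<Rightarrow> 'a vec" where
  "poly_act A x q =
     vec (dim_vec x) (\<lambda>i. \<Sum>k\<le>degree q. coeff q k * (((*\<^sub>v) A ^^ k) x $ i))"

lemma mult_mat_vec_funpow_carrier:
  assumes "A \<in> carrier_mat n n" "x \<in> carrier_vec n"
  shows "((*\<^sub>v) A ^^ k) x \<in> carrier_vec n"
  using assms by (induction k) auto

lemma poly_act_carrier [simp]: "x \<in> carrier_vec n \<Longrightarrow> poly_act A x q \<in> carrier_vec n"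
  by (simp add: poly_act_def)

text \<open>The free bound \<open>m\<close> puts polynomials of different degrees, such as
  \<open>pCons 0 r\<close> and \<open>r\<close>, under one common summation range.\<close>

lemma poly_act_index:
  assumes "x \<in> carrier_vec n" "i < n" "degree q \<le> m"
  shows "poly_act A x q $ i = (\<Sum>k\<le>m. coeff q k * (((*\<^sub>v) A ^^ k) x $ i))"
proof -
  have "(\<Sum>k\<le>degree q. coeff q k * (((*\<^sub>v) A ^^ k) x $ i)) =
        (\<Sum>k\<le>m. coeff q k * (((*\<^sub>v) A ^^ k) x $ i))"
    using assms by (intro sum.mono_neutral_left) (auto simp: coeff_eq_0)
  with assms show ?thesis by (simp add: poly_act_def)
qed

text \<open>Multiplying by X shifts coefficients, which amounts to one more application of
  \<open>A\<close>. The rule serves to peel a root off an annihilating polynomial.\<close>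

lemma poly_act_linear_factor:
  fixes A :: "'a :: idom mat"
  assumes A: "A \<in> carrier_mat n n" and x: "x \<in> carrier_vec n"
  shows "poly_act A x ([:-z, 1:] * r) = A *\<^sub>v poly_act A x r - z \<cdot>\<^sub>v poly_act A x r"
proof (rule eq_vecI)
  let ?a = "\<lambda>k. ((*\<^sub>v) A ^^ k) x"
  let ?m = "degree r"
  note a = mult_mat_vec_funpow_carrier[OF A x]
  show "dim_vec (poly_act A x ([:-z, 1:] * r)) =
        dim_vec (A *\<^sub>v poly_act A x r - z \<cdot>\<^sub>v poly_act A x r)"
    using A x by (simp add: poly_act_def)
  fix i assume "i < dim_vec (A *\<^sub>v poly_act A x r - z \<cdot>\<^sub>v poly_act A x r)"
  hence i: "i < n" using x by (simp add: poly_act_def)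
  have eq: "[:-z, 1:] * r = pCons 0 r - Polynomial.smult z r" by simp
  have deg: "degree ([:-z, 1:] * r) \<le> Suc ?m"
    using degree_mult_le[of "[:-z, 1:]" r] by simp
  have aS: "?a (Suc k) $ i = (\<Sum>j<n. A $$ (i, j) * ?a k $ j)" for k
    using A i a[of k] by (auto simp: scalar_prod_def lessThan_atLeast0 intro!: sum.cong)
  have "poly_act A x ([:-z, 1:] * r) $ i =
        (\<Sum>k\<le>Suc ?m. coeff (pCons 0 r - Polynomial.smult z r) k * ?a k $ i)"
    using poly_act_index[OF x i deg] unfolding eq .
  also have "\<dots> = (\<Sum>k\<le>Suc ?m. coeff (pCons 0 r) k * ?a k $ i)
                 - z * (\<Sum>k\<le>Suc ?m. coeff r k * ?a k $ i)"
    by (simp only: coeff_diff Polynomial.coeff_smult left_diff_distrib sum_subtractf sum_distrib_left mult.assoc)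
  also have "(\<Sum>k\<le>Suc ?m. coeff r k * ?a k $ i) = poly_act A x r $ i"
    by (rule poly_act_index[OF x i, symmetric]) simp
  also have "(\<Sum>k\<le>Suc ?m. coeff (pCons 0 r) k * ?a k $ i) =
             (\<Sum>k\<le>?m. coeff r k * ?a (Suc k) $ i)"
    by (subst sum.atMost_Suc_shift) simp
  also have "\<dots> = (\<Sum>k\<le>?m. \<Sum>j<n. A $$ (i, j) * (coeff r k * ?a k $ j))"
    unfolding aS by (simp add: sum_distrib_left mult_ac)
  also have "\<dots> = (\<Sum>j<n. A $$ (i, j) * (\<Sum>k\<le>?m. coeff r k * ?a k $ j))"
    by (subst sum.swap) (simp add: sum_distrib_left)
  also have "\<dots> = (\<Sum>j<n. A $$ (i, j) * poly_act A x r $ j)"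
    by (intro sum.cong) (simp_all add: poly_act_index[OF x _ order_refl])
  also have "\<dots> = (A *\<^sub>v poly_act A x r) $ i"
    using A i poly_act_carrier[OF x, of A r]
    by (auto simp: scalar_prod_def lessThan_atLeast0 intro!: sum.cong)
  finally show "poly_act A x ([:-z, 1:] * r) $ i =
                (A *\<^sub>v poly_act A x r - z \<cdot>\<^sub>v poly_act A x r) $ i"
    using i x A by (simp add: poly_act_def)
qed

text \<open>The n + 1 vectors x, A x, ..., A^n x in dimension n are linearly dependent; the
  coefficients of a dependency are those of \<open>q\<close>.\<close>

lemma ex_annihilating_poly:
  fixes A :: "'a :: field mat"
  assumes A: "A \<in> carrier_mat n n" and x: "x \<in> carrier_vec n"
  shows "\<exists>q. q \<noteq> 0 \<and> poly_act A x q = 0\<^sub>v n"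
proof -
  \<comment> \<open>The zero row makes the matrix of the \<open>n + 1\<close> vectors \<open>A\<^sup>k x\<close> square and singular.\<close>
  define C where
    "C = mat (Suc n) (Suc n) (\<lambda>(i, k). if i = n then 0 else ((*\<^sub>v) A ^^ k) x $ i)"
  have C: "C \<in> carrier_mat (Suc n) (Suc n)" by (simp add: C_def)
  \<comment> \<open>Every product in the Leibniz formula has a factor from the zero row.\<close>
  have "(\<Prod>i = 0..<Suc n. C $$ (i, \<pi> i)) = 0" if "\<pi> permutes {0..<Suc n}" for \<pi>
    using permutes_in_image[OF that, of n] by (simp add: C_def)
  hence "det C = 0"
    unfolding det_def'[OF C] by (intro sum.neutral) auto
  then obtain v where v: "v \<in> carrier_vec (Suc n)" "v \<noteq> 0\<^sub>v (Suc n)" "C *\<^sub>v v = 0\<^sub>v (Suc n)"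
    using det_0_iff_vec_prod_zero[OF C] by auto
  define q where "q = (\<Sum>k\<le>n. monom (v $ k) k)"
  have cq: "coeff q k = v $ k" if "k \<le> n" for k
    using that by (simp add: q_def coeff_sum)
  have dq: "degree q \<le> n"
    unfolding q_def by (intro degree_sum_le) (auto intro: order_trans[OF degree_monom_le])
  obtain k where "k \<le> n" "v $ k \<noteq> 0"
    using v(1,2) by (metis carrier_vecD eq_vecI index_zero_vec less_Suc_eq_le)
  hence "q \<noteq> 0" using cq by fastforce
  moreover have "poly_act A x q $ i = 0" if i: "i < n" for i
  proof -
    have "poly_act A x q $ i = (C *\<^sub>v v) $ i"
      using i v(1) unfolding poly_act_index[OF x i dq]
      by (auto simp: C_def scalar_prod_def cq mult.commute
          lessThan_Suc_atMost atLeast0LessThan intro!: sum.cong)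
    thus ?thesis using v(3) i by simp
  qed
  hence "poly_act A x q = 0\<^sub>v n"
    using poly_act_carrier[OF x, of A q] by (intro eq_vecI) auto
  ultimately show ?thesis by blast
qed

section \<open>Eigenvalues of real symmetric matrices\<close>

lemma real_symmetric_cscalar_prod:
  fixes A :: "real mat"
  assumes A: "A \<in> carrier_mat n n" "A\<^sup>T = A"
    and x: "x \<in> carrier_vec n" and y: "y \<in> carrier_vec n"
  defines "B \<equiv> map_mat complex_of_real A"
  shows "(B *\<^sub>v x) \<bullet>c y = x \<bullet>c (B *\<^sub>v y)"
proof -
  have sym: "A $$ (i, j) = A $$ (j, i)" if "i < n" "j < n" for i j
    using that A by (metis carrier_matD index_transpose_mat(1))
  have dB: "dim_row B = n" using A(1) by (simp add: B_def)
  have mv: "(B *\<^sub>v u) $ i = (\<Sum>j<n. complex_of_real (A $$ (i, j)) * u $ j)"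
    if "u \<in> carrier_vec n" "i < n" for u i
    using that A(1) by (auto simp: B_def scalar_prod_def lessThan_atLeast0 intro!: sum.cong)
  have "(B *\<^sub>v x) \<bullet>c y = (\<Sum>i<n. (\<Sum>j<n. complex_of_real (A $$ (i, j)) * x $ j) * cnj (y $ i))"
    using x y by (auto simp: scalar_prod_def lessThan_atLeast0 mv intro!: sum.cong)
  also have "\<dots> = (\<Sum>j<n. \<Sum>i<n. x $ j * cnj (complex_of_real (A $$ (j, i)) * y $ i))"
    unfolding sum_distrib_right
    by (subst sum.swap) (auto intro!: sum.cong simp: sym)
  also have "\<dots> = (\<Sum>j<n. x $ j * cnj (\<Sum>i<n. complex_of_real (A $$ (j, i)) * y $ i))"
    by (simp add: sum_distrib_left cnj_sum)
  also have "\<dots> = x \<bullet>c (B *\<^sub>v y)"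
    using x y dB
    by (auto simp: scalar_prod_def lessThan_atLeast0[symmetric] mv
        simp del: index_mult_mat_vec intro!: sum.cong)
  finally show ?thesis .
qed

text \<open>Self-adjointness forces z to be real; as a real root of the characteristic polynomial it
  is then an eigenvalue of \<open>A\<close> over the reals.\<close>

lemma real_symmetric_complex_eigenvalue:
  fixes A :: "real mat"
  assumes A: "A \<in> carrier_mat n n" "A\<^sup>T = A"
    and ev: "eigenvalue (map_mat complex_of_real A) z"
  shows "z \<in> complex_of_real ` spectrum A"
proof -
  let ?B = "map_mat complex_of_real A"
  have B: "?B \<in> carrier_mat n n" using A by simp
  obtain y where y: "y \<in> carrier_vec n" "y \<noteq> 0\<^sub>v n" "?B *\<^sub>v y = z \<cdot>\<^sub>v y"
    using ev A by (auto simp: eigenvalue_def eigenvector_def)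
  have "z * (y \<bullet>c y) = cnj z * (y \<bullet>c y)"
    using real_symmetric_cscalar_prod[OF A y(1) y(1)] y
    by (simp add: conjugate_smult_vec)
  moreover have "y \<bullet>c y \<noteq> 0" using y by simp
  ultimately have "cnj z = z" by simp
  then obtain r where r: "z = complex_of_real r"
    by (metis Reals_cases Reals_cnj_iff)
  have "of_real (poly (char_poly A) r) = poly (map_poly complex_of_real (char_poly A)) z"
    unfolding r by simp
  also have "\<dots> = 0"
    using ev eigenvalue_root_char_poly[OF B] of_real_hom.char_poly_hom[OF A(1)] by metis
  finally have "eigenvalue A r" using eigenvalue_root_char_poly[OF A(1)] by simp
  with r show ?thesis by (simp add: spectrum_def)
qed

text \<open>Complex scalars make a least-degree annihilator \<open>q\<close> of \<open>x\<close>
  split; once its roots are known to be simple and in the spectrum, its degree counts distinct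
  eigenvalues.\<close>

lemma card_spectrum_ge_annihilator_degree:
  fixes A :: "real mat"
  assumes A: "A \<in> carrier_mat n n" "A\<^sup>T = A" and x: "x \<in> carrier_vec n"
    and low: "\<And>q. q \<noteq> 0 \<Longrightarrow> degree q < m \<Longrightarrow> poly_act (map_mat complex_of_real A) x q \<noteq> 0\<^sub>v n"
  shows "m \<le> card (spectrum A)"
proof -
  let ?B = "map_mat complex_of_real A"
  let ?L = "poly_act ?B x"
  have B: "?B \<in> carrier_mat n n" using A by simp
  define P where "P = (\<lambda>q. q \<noteq> 0 \<and> ?L q = 0\<^sub>v n)"
  obtain q where q: "P q" and min: "\<And>r. P r \<Longrightarrow> degree q \<le> degree r"
    using ex_has_least_nat[of P _ degree] ex_annihilating_poly[OF B x] unfolding P_def by metis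
  have Lc: "?L r \<in> carrier_vec n" for r using x by simp
  \<comment> \<open>Dropping a linear factor lowers the degree, so minimality of \<open>q\<close>
    keeps the cofactor from annihilating \<open>x\<close>. For a root z, the vector
    \<open>?L r\<close> is thus an eigenvector.\<close>
  have nz: "?L r \<noteq> 0\<^sub>v n" if "q = [:-z, 1:] * r" for z r
  proof
    assume "?L r = 0\<^sub>v n"
    moreover have "r \<noteq> 0" using q that by (auto simp: P_def)
    moreover from this have "degree q = Suc (degree r)"
      unfolding that by (subst degree_mult_eq) auto
    ultimately show False using min[of r] by (simp add: P_def)
  qed
  have root: "z \<in> complex_of_real ` spectrum A" if "poly q z = 0" for z
  proof -
    from that obtain r where r: "q = [:-z, 1:] * r" by (auto simp: poly_eq_0_iff_dvd)
    have diff0: "?B *\<^sub>v ?L r - z \<cdot>\<^sub>v ?L r = 0\<^sub>v n"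
      using q poly_act_linear_factor[OF B x, of z r] r by (simp add: P_def)
    have "?B *\<^sub>v ?L r = z \<cdot>\<^sub>v ?L r"
    proof (rule eq_vecI)
      fix i assume "i < dim_vec (z \<cdot>\<^sub>v ?L r)"
      hence i: "i < n" using Lc[of r] by simp
      from arg_cong[OF diff0, of "\<lambda>v. v $ i"] show "(?B *\<^sub>v ?L r) $ i = (z \<cdot>\<^sub>v ?L r) $ i"
        using i B Lc[of r] by simp
    qed (use A Lc[of r] in auto)
    hence "eigenvalue ?B z"
      using nz[OF r] Lc[of r] B unfolding eigenvalue_def eigenvector_def by auto
    thus ?thesis by (rule real_symmetric_complex_eigenvalue[OF A])
  qed
  have simple: "order z q \<le> 1" for z
  proof (rule ccontr)
    assume "\<not> order z q \<le> 1"
    hence ord: "2 \<le> order z q" by simp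
    hence "[:-z, 1:] ^ 2 dvd q" using order_1 le_imp_power_dvd dvd_trans by blast
    then obtain r where r: "q = [:-z, 1:] * ([:-z, 1:] * r)"
      unfolding power2_eq_square dvd_def mult.assoc by blast
    have "poly q z = 0" unfolding r by simp
    from root[OF this] obtain t where t: "z = complex_of_real t" by auto
    define w where "w = ?L r"
    define y where "y = ?L ([:-z, 1:] * r)"
    have w: "w \<in> carrier_vec n" and y: "y \<in> carrier_vec n" using Lc by (auto simp: w_def y_def)
    have yw: "y = ?B *\<^sub>v w - z \<cdot>\<^sub>v w"
      unfolding y_def w_def by (rule poly_act_linear_factor[OF B x])
    have y0: "?B *\<^sub>v y - z \<cdot>\<^sub>v y = 0\<^sub>v n"
      using q poly_act_linear_factor[OF B x, of z "[:-z, 1:] * r"] r by (simp add: P_def y_def)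
    \<comment> \<open>Since \<open>B - z\<close> is self-adjoint, \<open>(B - z)\<^sup>2 w = 0\<close> forces \<open>(B - z) w = 0\<close>.\<close>
    have By: "?B *\<^sub>v y = z \<cdot>\<^sub>v y"
    proof (rule eq_vecI)
      fix i assume "i < dim_vec (z \<cdot>\<^sub>v y)"
      hence i: "i < n" using y by simp
      from arg_cong[OF y0, of "\<lambda>v. v $ i"] show "(?B *\<^sub>v y) $ i = (z \<cdot>\<^sub>v y) $ i"
        using i B y by simp
    qed (use A y in auto)
    have "y \<bullet>c y = (?B *\<^sub>v w) \<bullet>c y - (z \<cdot>\<^sub>v w) \<bullet>c y"
      using w y B by (subst (1) yw) (rule minus_scalar_prod_distrib, auto)
    also have "(?B *\<^sub>v w) \<bullet>c y = w \<bullet>c (z \<cdot>\<^sub>v y)"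
      using real_symmetric_cscalar_prod[OF A w y] By by simp
    \<comment> \<open>The scalar changes sides unconjugated because z is the real number
      \<open>t\<close>.\<close>
    also have "\<dots> = (z \<cdot>\<^sub>v w) \<bullet>c y"
      using w y by (simp add: conjugate_smult_vec t)
    finally have "y = 0\<^sub>v n" using y by simp
    with nz[OF r] show False by (simp add: y_def)
  qed
  have "rsquarefree q"
    using simple q by (auto simp: rsquarefree_def P_def le_Suc_eq)
  hence dec: "Polynomial.smult (lead_coeff q) (\<Prod>z | poly q z = 0. [:-z, 1:]) = q"
    by (rule complex_poly_decompose_rsquarefree)
  have "degree q = card {z. poly q z = 0}"
    using q by (subst dec[symmetric]) (simp add: P_def degree_prod_eq_sum_degree)
  moreover have "m \<le> degree q"
    using low[of q] q by (auto simp: P_def not_less[symmetric])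
  moreover have "card {z. poly q z = 0} \<le> card (complex_of_real ` spectrum A)"
    using root card_finite_spectrum[OF A(1)] by (intro card_mono) auto
  moreover have "\<dots> \<le> card (spectrum A)"
    using card_finite_spectrum[OF A(1)] by (intro card_image_le)
  ultimately show ?thesis by linarith
qed

text \<open>For a nonzero eigenvalue, the transpose of \<open>M\<close> carries eigenvectors of the
  large product to eigenvectors of the s by s product; the extra 1 accounts for the eigenvalue
  0.\<close>

lemma card_spectrum_gram_le:
  fixes M :: "'a :: field mat"
  assumes M: "M \<in> carrier_mat n s"
  shows "card (spectrum (M * M\<^sup>T)) \<le> s + 1"
proof -
  have Mt: "M\<^sup>T \<in> carrier_mat s n" using M by simp
  have G: "M\<^sup>T * M \<in> carrier_mat s s" using M by simp
  have "spectrum (M * M\<^sup>T) \<subseteq> insert 0 (spectrum (M\<^sup>T * M))"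
  proof
    fix k assume "k \<in> spectrum (M * M\<^sup>T)"
    then obtain v where v: "v \<in> carrier_vec n" "v \<noteq> 0\<^sub>v n" "(M * M\<^sup>T) *\<^sub>v v = k \<cdot>\<^sub>v v"
      using M by (auto simp: spectrum_def eigenvalue_def eigenvector_def)
    define w where "w = M\<^sup>T *\<^sub>v v"
    have w: "w \<in> carrier_vec s" using Mt v by (simp add: w_def)
    have Mw: "M *\<^sub>v w = k \<cdot>\<^sub>v v"
      using v(3) assoc_mult_mat_vec[OF M Mt v(1)] by (simp add: w_def)
    show "k \<in> insert 0 (spectrum (M\<^sup>T * M))"
    proof (cases "k = 0")
      case False
      have "w \<noteq> 0\<^sub>v s"
      proof
        assume "w = 0\<^sub>v s"
        moreover have "M *\<^sub>v 0\<^sub>v s = 0\<^sub>v n" using M by (intro eq_vecI) auto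
        ultimately have kv: "k \<cdot>\<^sub>v v = 0\<^sub>v n" using Mw by simp
        have "v $ i = 0" if "i < n" for i
          using arg_cong[OF kv, of "\<lambda>u. u $ i"] that False v(1) by simp
        hence "v = 0\<^sub>v n" using v(1) by (intro eq_vecI) auto
        with v show False by simp
      qed
      moreover have "(M\<^sup>T * M) *\<^sub>v w = k \<cdot>\<^sub>v w"
        using assoc_mult_mat_vec[OF Mt M w] Mw mult_mat_vec[OF Mt v(1)] by (simp add: w_def)
      ultimately show ?thesis
        using w G M unfolding spectrum_def eigenvalue_def eigenvector_def by auto
    qed simp
  qed
  hence "card (spectrum (M * M\<^sup>T)) \<le> card (insert 0 (spectrum (M\<^sup>T * M)))"
    using card_finite_spectrum[OF G] by (intro card_mono) auto
  also have "\<dots> \<le> s + 1"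
    using card_finite_spectrum[OF G] by (simp add: card_insert_if)
  finally show ?thesis .
qed

section \<open>Structure of clique-paths\<close>

text \<open>Extracts a cover of the edges by \<open>length ns\<close> cliques, the form from which
  the incidence matrix of the upper bound is built.\<close>

lemma clique_path_constr_cliques:
  assumes "clique_path_constr ns G K U"
  shows "\<exists>C. parcs G = {(x, y). x \<noteq> y \<and> (\<exists>i<length ns. x \<in> C i \<and> y \<in> C i)}"
  using assms
proof induction
  case (single n K)
  thus ?case by (intro exI[of _ "\<lambda>_. pverts K"]) (auto simp: complete_digraph_pair_def)
next
  case (glue ns G K U n L v)
  then obtain C where C: "parcs G = {(x, y). x \<noteq> y \<and> (\<exists>i<length ns. x \<in> C i \<and> y \<in> C i)}"
    by blast
  have L: "parcs L = {(x, y). x \<noteq> y \<and> x \<in> pverts L \<and> y \<in> pverts L}"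
    using glue.hyps by (auto simp: complete_digraph_pair_def)
  let ?C = "C(length ns := pverts L)"
  have "(\<exists>i<length (ns @ [n]). x \<in> ?C i \<and> y \<in> ?C i) \<longleftrightarrow>
        x \<in> pverts L \<and> y \<in> pverts L \<or> (\<exists>i<length ns. x \<in> C i \<and> y \<in> C i)" for x y
    by (simp add: less_Suc_eq) (metis less_irrefl)
  thus ?case by (intro exI[of _ ?C]) (auto simp: vertex_sum_def C L)
qed

text \<open>
  \<open>f\<close> is the distance from \<open>p 0\<close>, and each \<open>p (Suc j)\<close> has \<open>p j\<close> as its only neighbour that is
  closer to \<open>p 0\<close>.
\<close>

definition unique_geodesic :: "'a pair_pre_digraph \<Rightarrow> nat \<Rightarrow> ('a \<Rightarrow> nat) \<Rightarrow> (nat \<Rightarrow> 'a) \<Rightarrow> bool" where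
  "unique_geodesic G s f p \<longleftrightarrow>
     (\<forall>j\<le>s. p j \<in> pverts G \<and> f (p j) = j) \<and>
     (\<forall>x\<in>pverts G. f x = 0 \<longrightarrow> x = p 0) \<and>
     (\<forall>x y. (x, y) \<in> parcs G \<longrightarrow> f x \<le> Suc (f y)) \<and>
     (\<forall>j<s. (p (Suc j), p j) \<in> parcs G \<and>
            (\<forall>x. (p (Suc j), x) \<in> parcs G \<longrightarrow> f x \<le> j \<longrightarrow> x = p j))"

lemma clique_path_constr_unique_geodesic:
  assumes "clique_path_constr ns G K U" "\<forall>n\<in>set ns. n \<ge> 2"
  shows "parcs G \<subseteq> pverts G \<times> pverts G \<and> U \<subseteq> pverts G \<and> pverts K - U \<noteq> {} \<and>
         (\<forall>w\<in>pverts K - U. \<exists>f p. unique_geodesic G (length ns) f p \<and> p (length ns) = w)"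
  using assms
proof induction
  case (single n K)
  hence K: "finite (pverts K)" "2 \<le> card (pverts K)"
    "parcs K = {(x, y). x \<in> pverts K \<and> y \<in> pverts K \<and> x \<noteq> y}"
    by (auto simp: complete_digraph_pair_def)
  have "\<exists>f p. unique_geodesic K 1 f p \<and> p 1 = w" if w: "w \<in> pverts K" for w
  proof -
    have "\<not> pverts K \<subseteq> {w}" using K card_mono[of "{w}" "pverts K"] by auto
    then obtain u where u: "u \<in> pverts K" "u \<noteq> w" by blast
    have "unique_geodesic K 1 (\<lambda>x. if x = u then 0 else 1) (\<lambda>j. if j = 0 then u else w)"
      unfolding unique_geodesic_def using u w K(3) by (auto split: if_splits simp: le_Suc_eq)
    moreover have "(\<lambda>j. if j = 0 then u else w) (1::nat) = w" by simp
    ultimately show ?thesis by blast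
  qed
  moreover have "pverts K \<noteq> {}" using K by auto
  ultimately show ?case using K by auto
next
  case (glue ns G K U n L v)
  let ?s = "length ns"
  let ?H = "vertex_sum G L"
  have L: "finite (pverts L)" "2 \<le> card (pverts L)"
    "parcs L = {(x, y). x \<in> pverts L \<and> y \<in> pverts L \<and> x \<noteq> y}"
    using glue.hyps glue.prems by (auto simp: complete_digraph_pair_def)
  have GL: "pverts G \<inter> pverts L = {v}" by fact
  have IH: "parcs G \<subseteq> pverts G \<times> pverts G" "U \<subseteq> pverts G"
    "\<forall>w\<in>pverts K - U. \<exists>f p. unique_geodesic G ?s f p \<and> p ?s = w"
    using glue.IH glue.prems by auto
  obtain f p where g: "unique_geodesic G ?s f p" and pv: "p ?s = v"
    using IH(3) glue.hyps by blast
  have H: "pverts ?H = pverts G \<union> pverts L" "parcs ?H = parcs G \<union> parcs L"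
    by (auto simp: vertex_sum_def)
  note g' = g[unfolded unique_geodesic_def]
  have "\<exists>f p. unique_geodesic ?H (Suc ?s) f p \<and> p (Suc ?s) = w"
    if w: "w \<in> pverts L" "w \<notin> insert v U" for w
  proof -
    \<comment> \<open>The new clique meets \<open>G\<close> only in \<open>v\<close>, which lies at
      level \<open>?s\<close>, so all its other vertices get level \<open>Suc ?s\<close>.\<close>
    define f' where "f' x = (if x \<in> pverts G then f x else Suc ?s)" for x
    define p' where "p' = p(Suc ?s := w)"
    have wG: "w \<notin> pverts G" using w GL by auto
    have fL: "f' x = (if x = v then ?s else Suc ?s)" if "x \<in> pverts L" for x
      using that GL g' pv unfolding f'_def by auto
    have p'G: "p' j = p j" "p' j \<in> pverts G" "f' (p' j) = j" if "j \<le> ?s" for j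
      using that g' by (auto simp: p'_def f'_def)
    have p'w: "p' (Suc ?s) = w" by (simp add: p'_def)
    have "unique_geodesic ?H (Suc ?s) f' p'"
      unfolding unique_geodesic_def
    proof (intro conjI allI impI ballI)
      fix j assume "j \<le> Suc ?s"
      thus "p' j \<in> pverts ?H" "f' (p' j) = j"
        using p'G[of j] p'w w fL[of w] by (auto simp: H le_Suc_eq)
    next
      fix x assume "x \<in> pverts ?H" "f' x = 0"
      thus "x = p' 0" using p'G(1)[of 0] g' by (auto simp: f'_def split: if_splits)
    next
      fix x y assume "(x, y) \<in> parcs ?H"
      then consider "(x, y) \<in> parcs G" | "x \<in> pverts L" "y \<in> pverts L"
        using H L by auto
      thus "f' x \<le> Suc (f' y)"
      proof cases
        case 1
        thus ?thesis using IH(1) g' by (auto simp: f'_def)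
      qed (simp add: fL)
    next
      fix j assume j: "j < Suc ?s"
      show "(p' (Suc j), p' j) \<in> parcs ?H"
      proof (cases "j = ?s")
        case True
        thus ?thesis using p'w p'G(1)[of ?s] pv w GL by (auto simp: H L)
      next
        case False
        thus ?thesis using j g' p'G(1)[of j] p'G(1)[of "Suc j"] by (auto simp: H)
      qed
      fix x assume x: "(p' (Suc j), x) \<in> parcs ?H" "f' x \<le> j"
      show "x = p' j"
      proof (cases "j = ?s")
        case True
        hence "(w, x) \<in> parcs L" using x wG IH(1) by (auto simp: H p'w)
        hence "x \<in> pverts L" using L by auto
        thus ?thesis using x fL[of x] True p'G(1)[of ?s] pv by (auto split: if_splits)
      next
        case False
        hence j: "j < ?s" using j by simp
        have xG: "x \<in> pverts G" using x j by (auto simp: f'_def split: if_splits)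
        \<comment> \<open>An arc of \<open>L\<close> would have two distinct ends in both
          \<open>G\<close> and \<open>L\<close>, which share only \<open>v\<close>.\<close>
        have "(p (Suc j), x) \<in> parcs G"
        proof (rule ccontr)
          assume "(p (Suc j), x) \<notin> parcs G"
          hence "p (Suc j) \<in> pverts L" "x \<in> pverts L" "p (Suc j) \<noteq> x"
            using x p'G(1)[of "Suc j"] j by (auto simp: H L)
          moreover have "p (Suc j) \<in> pverts G" using g' j by auto
          ultimately show False using xG GL by (metis IntI singletonD)
        qed
        thus ?thesis using g' j x(2) xG p'G(1)[of j] by (auto simp: f'_def)
      qed
    qed
    with p'w show ?thesis by blast
  qed
  moreover have "\<not> pverts L \<subseteq> {v}" using L card_mono[of "{v}" "pverts L"] by auto
  \<comment> \<open>\<open>U\<close> lies in \<open>G\<close>, hence meets \<open>L\<close> at most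
    in \<open>v\<close>, while \<open>L\<close> has a second vertex.\<close>
  hence "pverts L - insert v U \<noteq> {}" using IH(2) GL by auto
  ultimately show ?case using IH(1,2) GL by (auto simp: H L)
qed

section \<open>Distinct eigenvalues of clique-paths\<close>

text \<open>Uniqueness of the shortest path rules out cancellation: a single walk contributes to the
  entry of the k-th iterate at \<open>p k\<close>.\<close>

lemma q_mat_ge_unique_geodesic:
  assumes g: "unique_geodesic G s f p" and V: "pverts G = {0..<n}"
    and A: "A \<in> sym_mats_of_graph G"
  shows "s + 1 \<le> q_mat A"
proof -
  have A': "A \<in> carrier_mat n n" "A\<^sup>T = A"
    and pat: "\<And>i j. i < n \<Longrightarrow> j < n \<Longrightarrow> i \<noteq> j \<Longrightarrow> A $$ (i, j) \<noteq> 0 \<longleftrightarrow> (i, j) \<in> parcs G"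
    using A V by (auto simp: sym_mats_of_graph_def)
  note g' = g[unfolded unique_geodesic_def V]
  define B where "B = map_mat complex_of_real A"
  define x where "x = (unit_vec n (p 0) :: complex vec)"
  let ?a = "\<lambda>k. ((*\<^sub>v) B ^^ k) x"
  have B: "B \<in> carrier_mat n n" and x: "x \<in> carrier_vec n"
    using A' by (auto simp: B_def x_def)
  note a = mult_mat_vec_funpow_carrier[OF B x]
  have p: "p j < n" "f (p j) = j" if "j \<le> s" for j using that g' by auto
  have step: "?a (Suc k) $ i = (\<Sum>j<n. B $$ (i, j) * ?a k $ j)" if "i < n" for k i
    using B that a[of k] by (auto simp: scalar_prod_def lessThan_atLeast0 intro!: sum.cong)
  have B0: "B $$ (i, j) = 0" if "i < n" "j < n" "i \<noteq> j" "(i, j) \<notin> parcs G" for i j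
    using that pat[of i j] A' by (auto simp: B_def)
  \<comment> \<open>Each application of \<open>B\<close> spreads the support by at most one level of
    \<open>f\<close>.\<close>
  have far: "?a k $ i = 0" if "i < n" "k < f i" for k i
    using that
  proof (induction k arbitrary: i)
    case 0
    hence "i \<noteq> p 0" using p(2)[of 0] by auto
    with 0 p(1)[of 0] show ?case by (simp add: x_def)
  next
    case (Suc k)
    have "B $$ (i, j) * ?a k $ j = 0" if "j < n" for j
    proof (cases "i = j \<or> (i, j) \<in> parcs G")
      case True
      hence "f i \<le> Suc (f j)" using g' by auto
      hence "k < f j" using Suc.prems by linarith
      thus ?thesis using Suc.IH[OF that] by simp
    next
      case False
      thus ?thesis using B0[of i j] Suc.prems that by auto
    qed
    thus ?case unfolding step[OF Suc.prems(1)] by (intro sum.neutral) auto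
  qed
  have near: "?a k $ p k \<noteq> 0" if "k \<le> s" for k
    using that
  proof (induction k)
    case 0
    thus ?case using p(1)[of 0] by (simp add: x_def)
  next
    case (Suc k)
    have arc: "(p (Suc k), p k) \<in> parcs G" using g' Suc.prems by auto
    have ne: "p (Suc k) \<noteq> p k" using p(2)[of k] p(2)[of "Suc k"] Suc.prems by auto
    \<comment> \<open>Beyond level k the iterate vanishes; up to level k the only neighbour of
      \<open>p (Suc k)\<close> is \<open>p k\<close>. So one term survives.\<close>
    have "B $$ (p (Suc k), j) * ?a k $ j = 0" if "j < n" "j \<noteq> p k" for j
    proof (cases "k < f j")
      case True
      thus ?thesis using far[OF that(1)] by simp
    next
      case False
      hence "(p (Suc k), j) \<notin> parcs G" "j \<noteq> p (Suc k)"
        using that g' Suc.prems p(2)[of "Suc k"] by auto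
      thus ?thesis using B0[of "p (Suc k)" j] p(1)[of "Suc k"] Suc.prems that by auto
    qed
    hence "?a (Suc k) $ p (Suc k) = (\<Sum>j\<in>{p k}. B $$ (p (Suc k), j) * ?a k $ j)"
      unfolding step[OF p(1)[OF Suc.prems]] using p(1)[of k] Suc.prems
      by (intro sum.mono_neutral_right) auto
    moreover have "B $$ (p (Suc k), p k) \<noteq> 0"
      using pat[of "p (Suc k)" "p k"] arc ne p(1)[of k] p(1)[of "Suc k"] Suc.prems A'
      by (auto simp: B_def)
    ultimately show ?case using Suc by auto
  qed
  have "poly_act B x q \<noteq> 0\<^sub>v n" if q: "q \<noteq> 0" "degree q < s + 1" for q
  proof
    let ?d = "degree q"
    assume z: "poly_act B x q = 0\<^sub>v n"
    have d: "?d \<le> s" using q by simp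
    \<comment> \<open>At this coordinate all lower powers vanish, leaving the leading coefficient
      times a nonzero entry.\<close>
    have "poly_act B x q $ p ?d = (\<Sum>k\<in>{?d}. coeff q k * ?a k $ p ?d)"
      unfolding poly_act_index[OF x p(1)[OF d] order_refl]
      using p[OF d] by (intro sum.mono_neutral_right) (auto simp: far)
    thus False using z near[OF d] q p(1)[OF d] by simp
  qed
  thus ?thesis
    using card_spectrum_ge_annihilator_degree[OF A' x, of "s + 1"]
    unfolding q_mat_def B_def by blast
qed

text \<open>With \<open>M\<close> the vertex-clique incidence matrix, an entry of the Gram matrix
  counts the cliques containing both vertices. Off the diagonal it is nonzero exactly on
  edges.\<close>

lemma ex_q_mat_le_cliques:
  assumes arcs: "parcs G = {(x, y). x \<noteq> y \<and> (\<exists>i<s. x \<in> C i \<and> y \<in> C i)}"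
  shows "\<exists>A\<in>sym_mats_of_graph G. q_mat A \<le> s + 1"
proof -
  let ?n = "card (pverts G)"
  define M :: "real mat" where "M = mat ?n s (\<lambda>(x, i). if x \<in> C i then 1 else 0)"
  have M: "M \<in> carrier_mat ?n s" by (simp add: M_def)
  have entry: "(M * M\<^sup>T) $$ (x, y) = (\<Sum>i<s. if x \<in> C i \<and> y \<in> C i then 1 else 0)"
    if "x < ?n" "y < ?n" for x y
    using that by (auto simp: M_def scalar_prod_def lessThan_atLeast0 intro!: sum.cong)
  have "(M * M\<^sup>T)\<^sup>T = M * M\<^sup>T"
    using M by (simp add: transpose_mult[of M ?n s "M\<^sup>T" ?n])
  moreover have "(M * M\<^sup>T) $$ (x, y) \<noteq> 0 \<longleftrightarrow> (x, y) \<in> parcs G"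
    if "x < ?n" "y < ?n" "x \<noteq> y" for x y
    using that by (auto simp: entry arcs sum_nonneg_eq_0_iff)
  ultimately have "M * M\<^sup>T \<in> sym_mats_of_graph G"
    using M by (auto simp: sym_mats_of_graph_def)
  moreover have "q_mat (M * M\<^sup>T) \<le> s + 1"
    unfolding q_mat_def by (rule card_spectrum_gram_le[OF M])
  ultimately show ?thesis by blast
qed

theorem theorem4p3:
  fixes ns :: "nat list" and G :: "nat pair_pre_digraph" and N :: nat
  assumes "length ns \<ge> 2"
    and "\<forall>n \<in> set ns. n \<ge> 2"
    and "clique_path ns G"
    and "pverts G = {0..<N}"
  shows "q_graph G = length ns + 1"
proof -
  obtain K U where constr: "clique_path_constr ns G K U"
    using assms(3) by (auto simp: clique_path_def)
  obtain f p where "unique_geodesic G (length ns) f p"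
    using clique_path_constr_unique_geodesic[OF constr assms(2)] by blast
  hence lower: "length ns + 1 \<le> q_mat A" if "A \<in> sym_mats_of_graph G" for A
    using q_mat_ge_unique_geodesic assms(4) that by blast
  obtain A where A: "A \<in> sym_mats_of_graph G" "q_mat A \<le> length ns + 1"
    using clique_path_constr_cliques[OF constr] ex_q_mat_le_cliques by blast
  have "q_mat A = length ns + 1" using A lower by (simp add: le_antisym)
  hence "length ns + 1 \<in> q_mat ` sym_mats_of_graph G" using A(1) by force
  thus ?thesis
    unfolding q_graph_def using lower by (intro cInf_eq_minimum) auto
qed

end
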